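(* Let $G=(V,E)$ be a connected amply regular graph with parameters $(n,d,\alpha,\beta)$ such that $2\beta-\alpha\geq d+1$. Then for any edge $xy\in E$ the Lin--Lu--Yau curvature satisfies \[ \kappa(x,y)=\frac{2+\alpha}{d}. \]
   Context: Graphs are finite and simple. An amply regular graph with parameters $(n,d,\alpha,\beta)$ is a $d$-regular graph on $n$ vertices such that (i) any two adjacent vertices have exactly $\alpha$ common neighbors, and (ii) any two vertices at distance $2$ have exactly $\beta$ common neighbors. The case $\alpha=0$ is allowed. Let $\mathrm{dist}(x,y)$ denote the combinatorial distance, i.e. the length of a shortest path connecting $x$ and $y$. For two probability measures $\mu_1,\mu_2$ on $V$, the Wasserstein distance is \[ W(\mu_1,\mu_2)=\inf_{\pi}\sum_{y\in V}\sum_{x\in V}\mathrm{dist}(x,y)\,\pi(x,y), \] where the infimum is over all maps $\pi:V\times V\to[0,1]$ with $\mu_1(x)=\sum_{z\in V}\pi(x,z)$ and $\mu_2(y)=\sum_{z\in V}\pi(z,y)$ for all $x,y\in V$. For $p\in[0,1]$ and $x\in V$, let $\mu_x^p$ be the probability measure with $\mu_x^p(x)=p$, $\mu_x^p(v)=\frac{1-p}{\deg(x)}$ if $v$ is adjacent to $x$, and $\mu_x^p(v)=0$ otherwise. The $p$-Ollivier--Ricci curvature of distinct vertices $x,y$ is $\kappa_p(x,y)=1-\frac{W(\mu_x^p,\mu_y^p)}{\mathrm{dist}(x,y)}$, and the Lin--Lu--Yau curvature is $\kappa(x,y)=\lim_{p\to 1}\frac{\kappa_p(x,y)}{1-p}$.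 *)

theory Defs
  imports Complex_Main "Graph_Theory.Shortest_Path" "Graph_Theory.Digraph_Component"
begin

text \<open>
  Finite simple graphs are the symmetric, loop-free digraphs without parallel arcs of the locale
  \<^locale>\<open>graph\<close>. An undirected edge is a pair of opposite arcs, so the degree of a vertex is its
  out-degree.
\<close>

definition common_neighbors :: "('a, 'b) pre_digraph \<Rightarrow> 'a \<Rightarrow> 'a \<Rightarrow> 'a set" where
  "common_neighbors G x y = {z \<in> verts G. x \<rightarrow>\<^bsub>G\<^esub> z \<and> y \<rightarrow>\<^bsub>G\<^esub> z}"

text \<open>
  With unit weights the cost of a walk is its length. The value is infinite if there is
  no walk, so vertices in different components are never at distance 2.
\<close>

definition edist :: "('a, 'b) pre_digraph \<Rightarrow> 'a \<Rightarrow> 'a \<Rightarrow> ereal" where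
  "edist G x y = wf_digraph.\<mu> G (\<lambda>_. 1) x y"

text \<open>The real-valued distance is only meaningful for vertices in the same component.\<close>

definition gdist :: "('a, 'b) pre_digraph \<Rightarrow> 'a \<Rightarrow> 'a \<Rightarrow> real" where
  "gdist G x y = real_of_ereal (edist G x y)"

definition amply_regular :: "('a, 'b) pre_digraph \<Rightarrow> nat \<Rightarrow> nat \<Rightarrow> nat \<Rightarrow> nat \<Rightarrow> bool" where
  "amply_regular G n d \<alpha> \<beta> \<longleftrightarrow>
     graph G \<and> card (verts G) = n \<and>
     (\<forall>x\<in>verts G. out_degree G x = d) \<and>
     (\<forall>x\<in>verts G. \<forall>y\<in>verts G. x \<rightarrow>\<^bsub>G\<^esub> y \<longrightarrow> card (common_neighbors G x y) = \<alpha>) \<and>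
     (\<forall>x\<in>verts G. \<forall>y\<in>verts G. edist G x y = 2 \<longrightarrow> card (common_neighbors G x y) = \<beta>)"

text \<open>Probability measures on the finite vertex set are given by their point masses.\<close>

definition couplings ::
  "('a, 'b) pre_digraph \<Rightarrow> ('a \<Rightarrow> real) \<Rightarrow> ('a \<Rightarrow> real) \<Rightarrow> ('a \<Rightarrow> 'a \<Rightarrow> real) set" where
  "couplings G \<mu>\<^sub>1 \<mu>\<^sub>2 = {\<pi>.
     (\<forall>x\<in>verts G. \<forall>y\<in>verts G. \<pi> x y \<in> {0..1}) \<and>
     (\<forall>x\<in>verts G. \<mu>\<^sub>1 x = (\<Sum>z\<in>verts G. \<pi> x z)) \<and>
     (\<forall>y\<in>verts G. \<mu>\<^sub>2 y = (\<Sum>z\<in>verts G. \<pi> z y))}"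

text \<open>
  For probability measures the infimum is over a nonempty set (it contains the product coupling)
  that is bounded below by 0.
\<close>

definition wasserstein ::
  "('a, 'b) pre_digraph \<Rightarrow> ('a \<Rightarrow> real) \<Rightarrow> ('a \<Rightarrow> real) \<Rightarrow> real" where
  "wasserstein G \<mu>\<^sub>1 \<mu>\<^sub>2 =
     (INF \<pi>\<in>couplings G \<mu>\<^sub>1 \<mu>\<^sub>2. \<Sum>y\<in>verts G. \<Sum>x\<in>verts G. gdist G x y * \<pi> x y)"

definition lazy_measure :: "('a, 'b) pre_digraph \<Rightarrow> real \<Rightarrow> 'a \<Rightarrow> 'a \<Rightarrow> real" where
  "lazy_measure G p x v =
     (if v = x then p
      else if x \<rightarrow>\<^bsub>G\<^esub> v then (1 - p) / real (out_degree G x)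
      else 0)"

definition ollivier_curvature :: "('a, 'b) pre_digraph \<Rightarrow> real \<Rightarrow> 'a \<Rightarrow> 'a \<Rightarrow> real" where
  "ollivier_curvature G p x y =
     1 - wasserstein G (lazy_measure G p x) (lazy_measure G p y) / gdist G x y"

text \<open>
  Since \<open>p\<close> ranges over \<open>[0,1]\<close>, the limit is one-sided. \<^const>\<open>Lim\<close> has an unspecified
  value where the limit does not exist, so \<open>has_lly_curvature\<close> states convergence explicitly.
\<close>

definition lly_curvature :: "('a, 'b) pre_digraph \<Rightarrow> 'a \<Rightarrow> 'a \<Rightarrow> real" where
  "lly_curvature G x y = Lim (at_left 1) (\<lambda>p. ollivier_curvature G p x y / (1 - p))"

definition has_lly_curvature :: "('a, 'b) pre_digraph \<Rightarrow> 'a \<Rightarrow> 'a \<Rightarrow> bool" where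
  "has_lly_curvature G x y \<longleftrightarrow>
     ((\<lambda>p. ollivier_curvature G p x y / (1 - p)) \<longlongrightarrow> lly_curvature G x y) (at_left 1)"

end

theory Submission
  imports Defs "HOL-Combinatorics.Transposition"
begin

text \<open>
  For an edge \<open>xy\<close> let \<open>A\<close> be the neighbours of \<open>x\<close> that are neither \<open>y\<close> nor adjacent to \<open>y\<close>, and
  \<open>B\<close> the symmetric set. Both have \<open>d - \<alpha> - 1\<close> elements. A vertex \<open>v \<in> A\<close> is at distance 2 from
  \<open>y\<close>; of the \<open>\<beta>\<close> common neighbours of \<open>v\<close> and \<open>y\<close>, one is \<open>x\<close>, at most \<open>\<alpha>\<close> are adjacent to \<open>x\<close>,
  and the others lie in \<open>B\<close>. The hypothesis makes these at least half of \<open>B\<close>, so \<open>A\<close> and \<open>B\<close> are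
  perfectly matched by edges. Moving mass along this matching and along \<open>xy\<close>, over distance 1 only,
  gives a coupling whose cost is the total variation distance of the two measures, a lower
  bound for the Wasserstein distance.
\<close>

section \<open>Perfect matchings from half-degree conditions\<close>

text \<open>
  Among all bijections take one that uses the most edges. If \<open>a\<close> is not matched along an edge, the
  degree condition yields an \<open>a'\<close> such that swapping the images of \<open>a\<close> and \<open>a'\<close> puts both on edges.
\<close>

lemma perfect_matching_if_half_degrees:
  fixes E :: "'a \<Rightarrow> 'b \<Rightarrow> bool"
  assumes "finite A" "finite B" and card_eq: "card A = card B"
    and degA: "\<And>a. a \<in> A \<Longrightarrow> card A \<le> 2 * card {b \<in> B. E a b}"
    and degB: "\<And>b. b \<in> B \<Longrightarrow> card B \<le> 2 * card {a \<in> A. E a b}"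
  obtains f where "bij_betw f A B" "\<And>a. a \<in> A \<Longrightarrow> E a (f a)"
proof -
  define M where "M f = {a \<in> A. E a (f a)}" for f
  obtain f\<^sub>0 where "bij_betw f\<^sub>0 A B"
    using finite_same_card_bij assms(1,2) card_eq by blast
  moreover have "\<forall>f. bij_betw f A B \<longrightarrow> card (M f) < Suc (card A)"
    using \<open>finite A\<close> by (auto simp: M_def less_Suc_eq_le intro: card_mono)
  ultimately obtain f where f: "bij_betw f A B"
    and f_max: "\<And>g. bij_betw g A B \<Longrightarrow> card (M g) \<le> card (M f)"
    using ex_has_greatest_nat[of "\<lambda>f. bij_betw f A B" f\<^sub>0 "\<lambda>f. card (M f)" "Suc (card A)"]
    by blast
  have "E a (f a)" if "a \<in> A" for a
  proof (rule ccontr)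
    assume not_edge: "\<not> E a (f a)"
    define S where "S = {a' \<in> A. E a (f a')}"
    define T where "T = {a' \<in> A. E a' (f a)}"
    have "f ` S = {b \<in> B. E a b}"
      using f by (auto simp: S_def bij_betw_def)
    moreover have "inj_on f S"
      using f by (auto simp: S_def bij_betw_def intro: inj_on_subset)
    ultimately have "card S = card {b \<in> B. E a b}"
      using card_image by fastforce
    then have "card A \<le> 2 * card S"
      using degA \<open>a \<in> A\<close> by simp
    moreover have "card A \<le> 2 * card T"
      using degB f \<open>a \<in> A\<close> card_eq by (auto simp: T_def bij_betw_def)
    \<comment> \<open>Pigeonhole: \<open>a\<close> lies in neither \<open>S\<close> nor
      \<open>T\<close>, so their union misses a point of \<open>A\<close>, while their sizes add up
      to at least \<open>card A\<close>. Hence they meet.\<close>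
    moreover have "card (S \<union> T) < card A"
      using not_edge \<open>a \<in> A\<close> \<open>finite A\<close>
      by (intro psubset_card_mono) (auto simp: S_def T_def)
    moreover have "card (S \<union> T) = card S + card T" if "S \<inter> T = {}"
      using that \<open>finite A\<close> by (intro card_Un_disjoint) (auto simp: S_def T_def)
    ultimately have "S \<inter> T \<noteq> {}"
      by auto
    then obtain a' where a': "a' \<in> A" "E a (f a')" "E a' (f a)"
      by (auto simp: S_def T_def)
    define g where "g = f \<circ> transpose a a'"
    have "bij_betw g A B"
      using f \<open>a \<in> A\<close> a'(1) by (simp add: g_def bij_betw_swap_iff)
    moreover have "M f \<subset> M g"
    proof
      show "M f \<subseteq> M g"
        using a' \<open>a \<in> A\<close> by (auto simp: M_def g_def transpose_def)
      have "a \<in> M g" "a \<notin> M f"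
        using a' \<open>a \<in> A\<close> not_edge by (auto simp: M_def g_def)
      then show "M f \<noteq> M g"
        by blast
    qed
    then have "card (M f) < card (M g)"
      using \<open>finite A\<close> by (intro psubset_card_mono) (auto simp: M_def)
    ultimately show False
      using f_max by fastforce
  qed
  with f that show thesis
    by blast
qed

section \<open>Distances 0, 1 and 2\<close>

context wf_digraph
begin

lemma edist_le_length: "awalk u p v \<Longrightarrow> edist G u v \<le> length p"
  using min_cost_le_walk_cost[of u p v "\<lambda>_. 1"]
  by (simp add: edist_def awalk_cost_def sum_list_triv)

lemma edist_greatest:
  assumes "\<And>p. awalk u p v \<Longrightarrow> k \<le> length p"
  shows "real k \<le> edist G u v"
  unfolding edist_def \<mu>_def using assms
  by (intro INF_greatest) (auto simp: awalk_cost_def sum_list_triv)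

lemma awalk_length_pos: "awalk u p v \<Longrightarrow> u \<noteq> v \<Longrightarrow> 1 \<le> length p"
  by (cases p) (auto simp: awalk_Nil_iff)

lemma edist_eq_2:
  assumes "u \<rightarrow>\<^bsub>G\<^esub> w" "w \<rightarrow>\<^bsub>G\<^esub> v" "u \<noteq> v" "\<not> u \<rightarrow>\<^bsub>G\<^esub> v"
  shows "edist G u v = 2"
proof (rule antisym)
  obtain e e' where "e \<in> arcs G" "tail G e = u" "head G e = w"
    "e' \<in> arcs G" "tail G e' = w" "head G e' = v"
    using assms(1,2) by blast
  then have "awalk u [e, e'] v"
    by (auto simp: awalk_simps)
  from edist_le_length[OF this] show "edist G u v \<le> 2"
    by simp
  have "2 \<le> length p" if "awalk u p v" for p
  proof -
    have "length p \<noteq> 1"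
    proof
      assume "length p = 1"
      then obtain e where "p = [e]"
        by (auto simp: length_Suc_conv)
      with that have "e \<in> arcs G" "arc_to_ends G e = (u, v)"
        by (auto simp: awalk_simps arc_to_ends_def)
      with assms(4) show False
        using dominatesI by blast
    qed
    with awalk_length_pos[OF that \<open>u \<noteq> v\<close>] show ?thesis
      by linarith
  qed
  from edist_greatest[OF this] show "2 \<le> edist G u v"
    by simp
qed

lemma gdist_self: "u \<in> verts G \<Longrightarrow> gdist G u u = 0"
proof -
  assume "u \<in> verts G"
  then have "edist G u u \<le> 0"
    using edist_le_length[of u "[]" u] by (simp add: awalk_Nil_iff zero_ereal_def)
  moreover have "0 \<le> edist G u u"
    using edist_greatest[of u u 0] by (simp add: zero_ereal_def)
  ultimately show ?thesis
    by (simp add: gdist_def)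
qed

text \<open>Reachability excludes the infinite distance, which \<open>real_of_ereal\<close> would
  turn into 0.\<close>

lemma gdist_ge_1:
  assumes "u \<rightarrow>\<^sup>*\<^bsub>G\<^esub> v" "u \<noteq> v"
  shows "1 \<le> gdist G u v"
proof -
  obtain p where "awalk u p v"
    using assms(1) by (auto simp: reachable_awalk)
  then have "edist G u v \<le> length p"
    by (rule edist_le_length)
  moreover have "1 \<le> edist G u v"
    using edist_greatest[of u v 1] awalk_length_pos assms(2) by (simp add: one_ereal_def)
  ultimately show ?thesis
    unfolding gdist_def by (cases "edist G u v") auto
qed

lemma gdist_adj:
  assumes "u \<rightarrow>\<^bsub>G\<^esub> v" "u \<noteq> v"
  shows "gdist G u v = 1"
proof (rule antisym)
  obtain e where "e \<in> arcs G" "tail G e = u" "head G e = v"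
    using assms(1) by blast
  then have "awalk u [e] v"
    by (auto simp: awalk_simps)
  from edist_le_length[OF this] have "edist G u v \<le> 1"
    by (simp add: one_ereal_def)
  then show "gdist G u v \<le> 1"
    unfolding gdist_def by (cases "edist G u v") auto
  show "1 \<le> gdist G u v"
    using assms by (intro gdist_ge_1) auto
qed

end

section \<open>Neighbourhoods as vertex sets\<close>

lemma (in digraph) out_degree_eq_card_neighbours: "out_degree G u = card {v. u \<rightarrow>\<^bsub>G\<^esub> v}"
proof -
  have "head G ` out_arcs G u = {v. u \<rightarrow>\<^bsub>G\<^esub> v}"
    by (auto simp: arcs_ends_conv)
  moreover have "inj_on (head G) (out_arcs G u)"
    by (auto intro!: inj_onI no_multi_arcs simp: arc_to_ends_def)
  ultimately show ?thesis
    unfolding out_degree_def using card_image by fastforce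
qed

lemma (in wf_digraph) common_neighbors_eq: "common_neighbors G u v = {w. u \<rightarrow>\<^bsub>G\<^esub> w} \<inter> {w. v \<rightarrow>\<^bsub>G\<^esub> w}"
  by (auto simp: common_neighbors_def dest: adj_in_verts)

lemma (in fin_digraph) finite_neighbours: "finite {v. u \<rightarrow>\<^bsub>G\<^esub> v}"
  by (rule finite_subset[OF _ finite_verts]) (auto dest: adj_in_verts)

section \<open>Bounding and computing the Wasserstein distance\<close>

text \<open>At most \<open>m\<^sub>2 u\<close> of the mass at \<open>u\<close> can stay there, and
  the rest travels at least distance 1. The bound is the total variation distance when
  \<open>S\<close> collects the points where \<open>m\<^sub>1\<close> exceeds
  \<open>m\<^sub>2\<close>.\<close>

lemma (in fin_digraph) coupling_cost_ge:
  assumes "strongly_connected G" "\<pi> \<in> couplings G m\<^sub>1 m\<^sub>2" "S \<subseteq> verts G"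
  shows "(\<Sum>u\<in>S. m\<^sub>1 u - m\<^sub>2 u) \<le> (\<Sum>v\<in>verts G. \<Sum>u\<in>verts G. gdist G u v * \<pi> u v)"
proof -
  have nonneg: "0 \<le> \<pi> u v" if "u \<in> verts G" "v \<in> verts G" for u v
    using assms(2) that by (auto simp: couplings_def)
  have gdist_ge: "(if u = v then 0 else 1) \<le> gdist G u v" if "u \<in> verts G" "v \<in> verts G" for u v
    using that assms(1) gdist_self gdist_ge_1[of u v] by auto
  have off_diag: "0 \<le> (\<Sum>v\<in>verts G. (if u = v then 0 else 1) * \<pi> u v)" if "u \<in> verts G" for u
    using nonneg that by (intro sum_nonneg) auto
  have "(\<Sum>u\<in>S. m\<^sub>1 u - m\<^sub>2 u) \<le> (\<Sum>u\<in>S. \<Sum>v\<in>verts G. (if u = v then 0 else 1) * \<pi> u v)"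
  proof (rule sum_mono)
    fix u assume "u \<in> S"
    with assms(3) have u: "u \<in> verts G" by blast
    have "m\<^sub>1 u = \<pi> u u + (\<Sum>v\<in>verts G - {u}. \<pi> u v)"
      using assms(2) u by (simp add: couplings_def sum.remove)
    moreover have "\<pi> u u \<le> m\<^sub>2 u"
      using assms(2) u nonneg by (auto simp: couplings_def intro: member_le_sum)
    moreover have "(\<Sum>v\<in>verts G. (if u = v then 0 else 1) * \<pi> u v) = (\<Sum>v\<in>verts G - {u}. \<pi> u v)"
      using u by (subst sum.remove[of _ u]) (auto intro!: sum.cong split: if_splits)
    ultimately show "m\<^sub>1 u - m\<^sub>2 u \<le> (\<Sum>v\<in>verts G. (if u = v then 0 else 1) * \<pi> u v)"
      by linarith
  qed
  also have "\<dots> \<le> (\<Sum>u\<in>verts G. \<Sum>v\<in>verts G. (if u = v then 0 else 1) * \<pi> u v)"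
    using assms(3) off_diag by (intro sum_mono2) auto
  also have "\<dots> \<le> (\<Sum>u\<in>verts G. \<Sum>v\<in>verts G. gdist G u v * \<pi> u v)"
    using gdist_ge nonneg by (intro sum_mono mult_right_mono) auto
  also have "\<dots> = (\<Sum>v\<in>verts G. \<Sum>u\<in>verts G. gdist G u v * \<pi> u v)"
    by (rule sum.swap)
  finally show ?thesis .
qed

lemma wasserstein_eqI:
  assumes "\<pi> \<in> couplings G m\<^sub>1 m\<^sub>2"
    and "(\<Sum>v\<in>verts G. \<Sum>u\<in>verts G. gdist G u v * \<pi> u v) = c"
    and "\<And>\<pi>. \<pi> \<in> couplings G m\<^sub>1 m\<^sub>2 \<Longrightarrow>
      c \<le> (\<Sum>v\<in>verts G. \<Sum>u\<in>verts G. gdist G u v * \<pi> u v)"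
  shows "wasserstein G m\<^sub>1 m\<^sub>2 = c"
  unfolding wasserstein_def using assms by (intro cInf_eq_minimum) auto

section \<open>Local structure around an edge\<close>

locale amply_regular_edge = graph G for G :: "('a, 'b) pre_digraph" (structure) +
  fixes n d \<alpha> \<beta> :: nat and x y :: 'a
  assumes regular: "amply_regular G n d \<alpha> \<beta>"
    and edge: "x \<rightarrow>\<^bsub>G\<^esub> y"
begin

abbreviation N :: "'a \<Rightarrow> 'a set" where
  "N u \<equiv> {v. u \<rightarrow>\<^bsub>G\<^esub> v}"

text \<open>The set \<open>A\<close> of the overview. The set \<open>B\<close> is the same notion
  for the reversed edge, \<open>amply_regular_edge.exclusive G y x\<close>.\<close>

definition exclusive :: "'a set" where
  "exclusive = {v. x \<rightarrow>\<^bsub>G\<^esub> v \<and> \<not> y \<rightarrow>\<^bsub>G\<^esub> v \<and> v \<noteq> y}"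

lemma edge_in_verts [simp]: "x \<in> verts G" "y \<in> verts G"
  using edge adj_in_verts by blast+

lemma edge_sym: "y \<rightarrow>\<^bsub>G\<^esub> x"
  using edge graph_symmetric by blast

lemma edge_neq: "x \<noteq> y"
  using edge adj_not_same by blast

text \<open>Makes every fact about \<open>A\<close> available for \<open>B\<close>, by interpreting
  the locale with the end points exchanged.\<close>

lemma swap: "amply_regular_edge G n d \<alpha> \<beta> y x"
  using regular edge_sym by unfold_locales auto

lemma finite_exclusive: "finite exclusive"
  by (rule finite_subset[OF _ finite_neighbours[of x]]) (auto simp: exclusive_def)

lemma card_neighbours: "u \<in> verts G \<Longrightarrow> card (N u) = d"
  using regular by (auto simp: amply_regular_def out_degree_eq_card_neighbours)

lemma card_common_adj: "u \<rightarrow>\<^bsub>G\<^esub> v \<Longrightarrow> card (N u \<inter> N v) = \<alpha>"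
  using regular adj_in_verts[of u v]
  by (auto simp: amply_regular_def common_neighbors_eq)

lemma d_pos: "0 < d"
  using card_neighbours[of x] edge finite_neighbours[of x] by (auto simp: card_gt_0_iff)

text \<open>The neighbours of \<open>x\<close> split into \<open>exclusive\<close>, the \<alpha>
  common neighbours with \<open>y\<close>, and \<open>y\<close> itself.\<close>

lemma degree_eq: "d = card exclusive + \<alpha> + 1"
proof -
  have "N x = exclusive \<union> (N x \<inter> N y) \<union> {y}"
    using edge by (auto simp: exclusive_def)
  then have "card (N x) = card (exclusive \<union> (N x \<inter> N y) \<union> {y})"
    by simp
  also have "\<dots> = card (exclusive \<union> (N x \<inter> N y)) + card {y}"
    using finite_exclusive finite_neighbours adj_not_same
    by (intro card_Un_disjoint) (auto simp: exclusive_def)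
  also have "card (exclusive \<union> (N x \<inter> N y)) = card exclusive + card (N x \<inter> N y)"
    using finite_exclusive finite_neighbours
    by (intro card_Un_disjoint) (auto simp: exclusive_def)
  finally show ?thesis
    using card_neighbours card_common_adj[OF edge] by simp
qed

lemma common_neighbours_bound:
  assumes "v \<in> exclusive"
  shows "\<beta> \<le> 1 + \<alpha> + card {w \<in> amply_regular_edge.exclusive G y x. v \<rightarrow>\<^bsub>G\<^esub> w}"
proof -
  let ?C = "{w \<in> amply_regular_edge.exclusive G y x. v \<rightarrow>\<^bsub>G\<^esub> w}"
  have v: "x \<rightarrow>\<^bsub>G\<^esub> v" "v \<rightarrow>\<^bsub>G\<^esub> x" "\<not> v \<rightarrow>\<^bsub>G\<^esub> y" "v \<noteq> y" "v \<in> verts G"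
    using assms graph_symmetric adj_in_verts unfolding exclusive_def by blast+
  have "edist G v y = 2"
    using v edge by (intro edist_eq_2[of v x y]) auto
  then have "\<beta> = card (N v \<inter> N y)"
    using regular v(5) by (simp add: amply_regular_def common_neighbors_eq)
  also have "\<dots> \<le> card ({x} \<union> (N v \<inter> N x) \<union> ?C)"
    using finite_neighbours[of v]
    by (intro card_mono) (auto simp: amply_regular_edge.exclusive_def[OF swap])
  also have "\<dots> \<le> card ({x} \<union> (N v \<inter> N x)) + card ?C"
    by (rule card_Un_le)
  also have "card ({x} \<union> (N v \<inter> N x)) \<le> 1 + \<alpha>"
    using card_Un_le[of "{x}" "N v \<inter> N x"] card_common_adj[OF v(2)] by simp
  finally show ?thesis
    by simp
qed

lemma exclusive_matching:
  assumes "d + \<alpha> + 1 \<le> 2 * \<beta>"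
  obtains f where "bij_betw f exclusive (amply_regular_edge.exclusive G y x)"
    "\<And>v. v \<in> exclusive \<Longrightarrow> v \<rightarrow>\<^bsub>G\<^esub> f v"
proof -
  interpret S: amply_regular_edge G n d \<alpha> \<beta> y x
    by (rule swap)
  have card_eq: "card exclusive = card S.exclusive"
    using degree_eq S.degree_eq by simp
  show thesis
  proof (rule perfect_matching_if_half_degrees[of exclusive S.exclusive "dominates G"])
    fix v assume "v \<in> exclusive"
    \<comment> \<open>The hypothesis is exactly what is required: \<open>card exclusive\<close> is d
      - \<alpha> - 1, and twice the guaranteed \<beta> - 1 - \<alpha> neighbours reaches this iff d
      + \<alpha> + 1 \<le> 2\<beta>.\<close>
    from common_neighbours_bound[OF this] show "card exclusive \<le> 2 * card {w \<in> S.exclusive. v \<rightarrow>\<^bsub>G\<^esub> w}"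
      using degree_eq assms by linarith
  next
    fix v assume "v \<in> S.exclusive"
    moreover have "{w \<in> exclusive. w \<rightarrow>\<^bsub>G\<^esub> v} = {w \<in> exclusive. v \<rightarrow>\<^bsub>G\<^esub> w}"
      using graph_symmetric by blast
    ultimately show "card S.exclusive \<le> 2 * card {w \<in> exclusive. w \<rightarrow>\<^bsub>G\<^esub> v}"
      using S.common_neighbours_bound[of v] S.degree_eq assms by simp
  qed (use that card_eq finite_exclusive S.finite_exclusive in auto)
qed

section \<open>Optimal transport between the lazy measures\<close>

abbreviation closed :: "'a \<Rightarrow> 'a set" where
  "closed u \<equiv> insert u (N u)"

text \<open>The closed neighbourhoods differ only in \<open>A\<close> and \<open>B\<close>. The
  matching between these is extended by the identity on the shared part \<open>?K\<close>, where
  mass can stay at no cost.\<close>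

lemma closed_matching:
  assumes "d + \<alpha> + 1 \<le> 2 * \<beta>"
  obtains g where "bij_betw g (closed x) (closed y)"
    "\<And>u. u \<in> exclusive \<Longrightarrow> u \<rightarrow>\<^bsub>G\<^esub> g u" "\<And>u. u \<notin> exclusive \<Longrightarrow> g u = u"
proof -
  interpret S: amply_regular_edge G n d \<alpha> \<beta> y x
    by (rule swap)
  obtain f where f: "bij_betw f exclusive S.exclusive" "\<And>v. v \<in> exclusive \<Longrightarrow> v \<rightarrow>\<^bsub>G\<^esub> f v"
    using exclusive_matching[OF assms] by blast
  define g where "g u = (if u \<in> exclusive then f u else u)" for u
  let ?K = "{x, y} \<union> (N x \<inter> N y)"
  have "bij_betw g (exclusive \<union> ?K) (S.exclusive \<union> ?K)"
  proof (rule bij_betw_combine)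
    show "bij_betw g exclusive S.exclusive"
      using f(1) by (rule bij_betw_cong[THEN iffD1, rotated]) (simp add: g_def)
    show "bij_betw g ?K ?K"
      by (rule bij_betw_cong[THEN iffD1, OF _ bij_betw_id])
        (use adj_not_same in \<open>auto simp: g_def exclusive_def\<close>)
    show "S.exclusive \<inter> ?K = {}"
      using adj_not_same by (auto simp: S.exclusive_def)
  qed
  moreover have "exclusive \<union> ?K = closed x" "S.exclusive \<union> ?K = closed y"
    using edge edge_sym by (auto simp: exclusive_def S.exclusive_def)
  ultimately show thesis
    using f(2) by (intro that[of g]) (auto simp: g_def)
qed

text \<open>Splits the mass at the centre so that the measure becomes a uniform part on the closed
  neighbourhood plus an atom; the two parts are transported separately.\<close>

lemma lazy_measure_eq:
  fixes p :: real
  assumes "u \<rightarrow>\<^bsub>G\<^esub> u'"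
  shows "lazy_measure G p u v =
    (p - (1 - p) / d) * of_bool (v = u) + (1 - p) / d * of_bool (v \<in> closed u)"
  using regular adj_in_verts(1)[OF assms]
  by (auto simp: lazy_measure_def amply_regular_def)

lemma wasserstein_lazy_measure:
  fixes p :: real
  assumes "strongly_connected G" and deg: "d + \<alpha> + 1 \<le> 2 * \<beta>" and "1 / 2 \<le> p" "p \<le> 1"
  shows "wasserstein G (lazy_measure G p x) (lazy_measure G p y) = 1 - (1 - p) * (2 + \<alpha>) / d"
proof -
  interpret S: amply_regular_edge G n d \<alpha> \<beta> y x
    by (rule swap)
  define q where "q = (1 - p) / d"
  have q: "0 \<le> q" "q \<le> p" "q * d = 1 - p"
  proof -
    \<comment> \<open>With p \<ge> 1/2 this gives q \<le> p, so the atom of weight p - q is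
      nonnegative.\<close>
    have "q \<le> 1 - p"
      using d_pos assms by (simp add: q_def divide_le_eq mult_le_cancel_left1)
    then show "q \<le> p"
      using assms by linarith
  qed (use d_pos assms in \<open>auto simp: q_def\<close>)
  obtain g where g: "bij_betw g (closed x) (closed y)"
    and g_adj: "\<And>u. u \<in> exclusive \<Longrightarrow> u \<rightarrow>\<^bsub>G\<^esub> g u" and g_fix: "\<And>u. u \<notin> exclusive \<Longrightarrow> g u = u"
    using closed_matching[OF deg] by blast
  define h where "h = inv_into (closed x) g"
  have closed_verts: "closed x \<subseteq> verts G" "closed y \<subseteq> verts G"
    using adj_in_verts by auto
  have g_in: "g u \<in> closed y" if "u \<in> closed x" for u
    using g that by (rule bij_betwE[rule_format])
  have h_in: "h v \<in> closed x" if "v \<in> closed y" for v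
    using bij_betw_inv_into[OF g] that unfolding h_def by (rule bij_betwE[rule_format])
  \<comment> \<open>Describes the graph of \<open>g\<close> through its inverse \<open>h\<close>, so
    that in a column sum, where \<open>v\<close> is fixed, a single \<open>u\<close>
    contributes.\<close>
  have gh: "u \<in> closed x \<and> v = g u \<longleftrightarrow> v \<in> closed y \<and> u = h v" for u v
    using g_in h_in bij_betw_inv_into_left[OF g] bij_betw_inv_into_right[OF g]
    unfolding h_def by metis
  have mx: "lazy_measure G p x u = (p - q) * of_bool (u = x) + q * of_bool (u \<in> closed x)" for u
    unfolding q_def by (rule lazy_measure_eq[OF edge])
  have my: "lazy_measure G p y u = (p - q) * of_bool (u = y) + q * of_bool (u \<in> closed y)" for u
    unfolding q_def by (rule lazy_measure_eq[OF edge_sym])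
  \<comment> \<open>The transport plan: the atom moves along the edge from \<open>x\<close> to
    \<open>y\<close>, the uniform part along \<open>g\<close>.\<close>
  define \<pi> where
    "\<pi> u v = (p - q) * of_bool (u = x \<and> v = y) + q * of_bool (u \<in> closed x \<and> v = g u)" for u v
  \<comment> \<open>The weight \<open>c\<close> is 1 for the first marginal and the distance from
    \<open>u\<close> for the cost.\<close>
  have row: "(\<Sum>v\<in>verts G. c v * \<pi> u v) =
      c y * (p - q) * of_bool (u = x) + c (g u) * q * of_bool (u \<in> closed x)"
    for u and c :: "'a \<Rightarrow> real"
  proof -
    have "(\<Sum>v\<in>verts G. c v * \<pi> u v) =
        (\<Sum>v\<in>verts G. (if v = y then c y * (p - q) * of_bool (u = x) else 0)
          + (if v = g u then c (g u) * q * of_bool (u \<in> closed x) else 0))"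
      by (intro sum.cong) (auto simp: \<pi>_def algebra_simps)
    also have "\<dots> = c y * (p - q) * of_bool (u = x) + c (g u) * q * of_bool (u \<in> closed x)"
      using g_in[of u] closed_verts(2)
      by (cases "u \<in> closed x") (auto simp: sum.distrib subset_iff simp del: insert_iff)
    finally show ?thesis .
  qed
  have column: "(\<Sum>u\<in>verts G. \<pi> u v) = lazy_measure G p y v" for v
  proof -
    have "(\<Sum>u\<in>verts G. \<pi> u v) =
        (\<Sum>u\<in>verts G. (if u = x then (p - q) * of_bool (v = y) else 0)
          + (if u = h v then q * of_bool (v \<in> closed y) else 0))"
      by (intro sum.cong) (auto simp only: \<pi>_def gh of_bool_def split: if_splits)
    also have "\<dots> = lazy_measure G p y v"
      using h_in[of v] closed_verts(1)
      by (cases "v \<in> closed y") (auto simp: sum.distrib my subset_iff simp del: insert_iff)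
    finally show ?thesis .
  qed
  have bounds: "\<pi> u v \<in> {0..1}" for u v
    using q assms by (auto simp: \<pi>_def)
  \<comment> \<open>Substituting d = \<open>card exclusive\<close> + \<alpha> + 1 into q d = 1 - p
    turns the claimed value into the cost of the plan: the atom and the mass on
    \<open>exclusive\<close> each travel distance 1.\<close>
  have "1 - (1 - p) * (2 + \<alpha>) / d = 1 - q * (2 + \<alpha>)"
    by (simp add: q_def)
  also have "\<dots> = p - q + q * card exclusive"
    using q(3) degree_eq by (simp add: algebra_simps)
  finally have cost: "1 - (1 - p) * (2 + \<alpha>) / d = p - q + q * card exclusive" .
  show ?thesis
    unfolding cost
  proof (rule wasserstein_eqI)
    show "\<pi> \<in> couplings G (lazy_measure G p x) (lazy_measure G p y)"
      using bounds column row[of "\<lambda>_. 1"] by (simp add: couplings_def mx)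
    have "(\<Sum>v\<in>verts G. \<Sum>u\<in>verts G. gdist G u v * \<pi> u v)
        = (\<Sum>u\<in>verts G. \<Sum>v\<in>verts G. gdist G u v * \<pi> u v)"
      by (rule sum.swap)
    also have "\<dots> = (\<Sum>u\<in>verts G. (if u = x then p - q else 0) + q * of_bool (u \<in> exclusive))"
    proof (rule sum.cong)
      fix u assume u: "u \<in> verts G"
      have "gdist G u (g u) * q * of_bool (u \<in> closed x) = q * of_bool (u \<in> exclusive)"
      proof (cases "u \<in> exclusive")
        case True
        then have "u \<rightarrow>\<^bsub>G\<^esub> g u" "u \<in> closed x"
          using g_adj by (auto simp: exclusive_def)
        moreover from this have "u \<noteq> g u"
          using adj_not_same by metis
        ultimately show ?thesis
          using True by (simp add: gdist_adj)
      qed (use u g_fix gdist_self in auto)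
      then show "(\<Sum>v\<in>verts G. gdist G u v * \<pi> u v)
          = (if u = x then p - q else 0) + q * of_bool (u \<in> exclusive)"
        using gdist_adj[OF edge edge_neq] by (cases "u = x") (simp_all add: row del: insert_iff)
    qed simp
    also have "\<dots> = p - q + q * card (verts G \<inter> exclusive)"
      by (simp add: sum.distrib flip: sum_distrib_left)
    also have "verts G \<inter> exclusive = exclusive"
      using closed_verts by (auto simp: exclusive_def)
    finally show "(\<Sum>v\<in>verts G. \<Sum>u\<in>verts G. gdist G u v * \<pi> u v) = p - q + q * card exclusive" .
  next
    fix \<pi>' assume \<pi>': "\<pi>' \<in> couplings G (lazy_measure G p x) (lazy_measure G p y)"
    \<comment> \<open>The positive part of the difference of the measures lives on
      \<open>insert x exclusive\<close>: p - q at \<open>x\<close> and q at each point of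
      \<open>exclusive\<close>. This set makes the lower bound equal to the cost of the
      plan.\<close>
    have "x \<notin> exclusive"
      using adj_not_same by (auto simp: exclusive_def)
    moreover have "lazy_measure G p x x - lazy_measure G p y x = p - q"
      using edge_sym edge_neq by (simp add: mx my)
    moreover have "lazy_measure G p x u - lazy_measure G p y u = q" if "u \<in> exclusive" for u
      using that adj_not_same by (auto simp: mx my exclusive_def)
    ultimately have
      "p - q + q * card exclusive =
        (\<Sum>u\<in>insert x exclusive. lazy_measure G p x u - lazy_measure G p y u)"
      using finite_exclusive by simp
    also have "\<dots> \<le> (\<Sum>v\<in>verts G. \<Sum>u\<in>verts G. gdist G u v * \<pi>' u v)"
      using closed_verts by (intro coupling_cost_ge[OF assms(1) \<pi>']) (auto simp: exclusive_def)
    finally show "p - q + q * card exclusive \<le> (\<Sum>v\<in>verts G. \<Sum>u\<in>verts G. gdist G u v * \<pi>' u v)" .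
  qed
qed

section \<open>The limit defining the curvature\<close>

text \<open>The Wasserstein distance is affine in p on [1/2, 1] with value 1 at p = 1, so the
  quotient is constant for p strictly between 1/2 and 1.\<close>

lemma tendsto_ollivier_curvature:
  assumes "strongly_connected G" "d + \<alpha> + 1 \<le> 2 * \<beta>"
  shows "((\<lambda>p. ollivier_curvature G p x y / (1 - p)) \<longlongrightarrow> (2 + \<alpha>) / d) (at_left 1)"
proof (rule tendsto_eventually)
  have "ollivier_curvature G p x y / (1 - p) = (2 + \<alpha>) / d" if "1 / 2 < p" "p < 1" for p
    using that wasserstein_lazy_measure[OF assms, of p] gdist_adj[OF edge edge_neq]
    by (simp add: ollivier_curvature_def)
  then show "\<forall>\<^sub>F p in at_left 1. ollivier_curvature G p x y / (1 - p) = (2 + \<alpha>) / d"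
    by (intro eventually_at_leftI[of "1 / 2"]) auto
qed

end

theorem proposition3p6:
  fixes G :: "('a, 'b) pre_digraph" and n d \<alpha> \<beta> :: nat and x y :: 'a
  assumes "amply_regular G n d \<alpha> \<beta>"
    and "Digraph_Component.connected G"
    and "2 * int \<beta> - int \<alpha> \<ge> int d + 1"
    and "x \<rightarrow>\<^bsub>G\<^esub> y"
  shows "has_lly_curvature G x y \<and> lly_curvature G x y = (2 + real \<alpha>) / real d"
proof -
  interpret graph G
    using assms(1) by (simp add: amply_regular_def)
  interpret amply_regular_edge G n d \<alpha> \<beta> x y
    using assms(1,4) by unfold_locales
  \<comment> \<open>Arcs come in opposite pairs, so connectedness yields directed walks between all
    vertices and thus finite distances.\<close>
  have "strongly_connected G"
    using symmetric_connected_imp_strongly_connected assms(2) by blast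
  then have lim: "((\<lambda>p. ollivier_curvature G p x y / (1 - p)) \<longlongrightarrow> (2 + \<alpha>) / d) (at_left 1)"
    using assms(3) by (intro tendsto_ollivier_curvature) auto
  then have "lly_curvature G x y = (2 + \<alpha>) / d"
    unfolding lly_curvature_def by (intro tendsto_Lim) auto
  with lim show ?thesis
    by (simp add: has_lly_curvature_def)
qed

end
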